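(* Let $d\geq 5$ and let $\mathcal{R}=\{A_0=I,A_1,\ldots,A_d\}$ be a symmetric $d$-class association scheme. If the fusing-relations $3$-hypergraph of $\mathcal{R}$ contains, as subhypergraphs, two different $3$-sunflowers on the vertex set $\{A_1,\ldots,A_d\}$, then $\mathcal{R}$ is amorphic.
   Context: Symmetric $d$-class association scheme: for a finite set $X$, a collection $\mathcal{R}=\{A_0,A_1,\ldots,A_d\}$ of nonzero $X\times X$ $\{0,1\}$-matrices such that $A_0=I$; $\sum_{i=0}^d A_i=J$ (all-one matrix); $A_i^\top=A_i$ for all $i$; and there are numbers $p_{ij}^h$ with $A_iA_j=\sum_{h=0}^d p_{ij}^hA_h$ for all $i,j$. The matrices $A_1,\ldots,A_d$ are the (nontrivial) relations. Fusion: for a partition $\pi=\{\pi(0),\pi(1),\ldots,\pi(d')\}$ of $\{0,1,\ldots,d\}$ with $\pi(0)=\{0\}$, let $\mathcal{R}_\pi=\{\sum_{i\in\pi(s)}A_i : 0\le s\le d'\}$. If $\mathcal{R}_\pi$ is an association scheme it is called a fusion scheme of $\mathcal{R}$. $\mathcal{R}$ is amorphic if $\mathcal{R}_\pi$ is a fusion scheme for every such partition $\pi$. A set $\{A_i : i\in \mathcal{I}\}$ of relations ($\mathcal{I}\subseteq\{1,\ldots,d\}$) fuses if $\mathcal{R}_\pi$ is a fusion scheme for the partition $\pi$ whose blocks are $\mathcal{I}$ and the singletons $\{i\}$, $i\in\{0,\ldots,d\}\setminus\mathcal{I}$. The fusing-relations $3$-hypergraph of $\mathcal{R}$ is the $3$-uniform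 hypergraph on vertex set $\{A_1,\ldots,A_d\}$ in which three distinct vertices form an edge if and only if the set of these three relations fuses. A $3$-sunflower is a $3$-uniform hypergraph such that the intersection of all its edges is a set of size $2$ (its core) and the union of all its edges is its vertex set. Two $3$-sunflowers on a common vertex set are different if their cores are not the same. A hypergraph $\mathcal{H}_1$ is a subhypergraph of $\mathcal{H}_2$ if every edge of $\mathcal{H}_1$ is an edge of $\mathcal{H}_2$. *)

theory Defs
  imports "HOL-Analysis.Analysis" "HOL-Library.Disjoint_Sets"
begin

section \<open>Symmetric association schemes\<close>

text \<open>
  The point set \<open>X\<close> is the finite index type \<open>'x\<close>; the matrices of a scheme form a family
  \<open>A\<close> over a finite index set \<open>I\<close>, with \<open>z \<in> I\<close> the index of the identity matrix. A
  \<open>d\<close>-class scheme is the case \<open>I = {0..d}\<close>, \<open>z = 0\<close>; the index set is kept general so that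
  the matrices of a fusion can be indexed by the blocks of the partition.
\<close>

definition symmetric_scheme :: "'i set \<Rightarrow> 'i \<Rightarrow> ('i \<Rightarrow> real^'x^'x) \<Rightarrow> bool" where
  "symmetric_scheme I z A \<longleftrightarrow>
     finite I \<and> z \<in> I \<and>
     (\<forall>i\<in>I. A i \<noteq> 0 \<and> (\<forall>x y. A i $ x $ y \<in> {0, 1})) \<and>
     A z = mat 1 \<and>
     (\<Sum>i\<in>I. A i) = (\<chi> x y. 1) \<and>
     (\<forall>i\<in>I. transpose (A i) = A i) \<and>
     (\<exists>p :: 'i \<Rightarrow> 'i \<Rightarrow> 'i \<Rightarrow> real.
        \<forall>i\<in>I. \<forall>j\<in>I. A i ** A j = (\<Sum>h\<in>I. p i j h *\<^sub>R A h))"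

definition fusion_scheme :: "nat \<Rightarrow> (nat \<Rightarrow> real^'x^'x) \<Rightarrow> nat set set \<Rightarrow> bool" where
  "fusion_scheme d A \<pi> \<longleftrightarrow>
     partition_on {0..d} \<pi> \<and> {0} \<in> \<pi> \<and>
     symmetric_scheme \<pi> {0} (\<lambda>B. \<Sum>i\<in>B. A i)"

definition amorphic :: "nat \<Rightarrow> (nat \<Rightarrow> real^'x^'x) \<Rightarrow> bool" where
  "amorphic d A \<longleftrightarrow>
     (\<forall>\<pi>. partition_on {0..d} \<pi> \<and> {0} \<in> \<pi> \<longrightarrow> fusion_scheme d A \<pi>)"

definition fuses :: "nat \<Rightarrow> (nat \<Rightarrow> real^'x^'x) \<Rightarrow> nat set \<Rightarrow> bool" where
  "fuses d A J \<longleftrightarrow>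
     J \<subseteq> {1..d} \<and> fusion_scheme d A (insert J ((\<lambda>i. {i}) ` ({0..d} - J)))"


section \<open>3-uniform hypergraphs\<close>

text \<open>A hypergraph is the pair of its vertex set and its set of edges.\<close>

type_synonym 'v hypergraph = "'v set \<times> 'v set set"

abbreviation hverts :: "'v hypergraph \<Rightarrow> 'v set" where "hverts H \<equiv> fst H"

abbreviation hedges :: "'v hypergraph \<Rightarrow> 'v set set" where "hedges H \<equiv> snd H"

definition three_uniform :: "'v hypergraph \<Rightarrow> bool" where
  "three_uniform H \<longleftrightarrow> (\<forall>e\<in>hedges H. e \<subseteq> hverts H \<and> card e = 3)"

definition core :: "'v hypergraph \<Rightarrow> 'v set" where
  "core H = \<Inter>(hedges H)"

text \<open>
  The edge set is required to be nonempty because \<open>\<Inter>{}\<close> is \<open>UNIV\<close>, which is not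
  the meaning of ``the intersection of all edges''.
\<close>

definition three_sunflower :: "'v hypergraph \<Rightarrow> bool" where
  "three_sunflower H \<longleftrightarrow>
     three_uniform H \<and> hedges H \<noteq> {} \<and> card (core H) = 2 \<and> \<Union>(hedges H) = hverts H"

definition subhypergraph :: "'v hypergraph \<Rightarrow> 'v hypergraph \<Rightarrow> bool" where
  "subhypergraph H1 H2 \<longleftrightarrow> hedges H1 \<subseteq> hedges H2"

text \<open>
  The vertices are the matrices themselves. The matrices of a scheme are pairwise distinct, so
  the edges below are exactly the triples of distinct relations that fuse.
\<close>

definition fusing_hypergraph :: "nat \<Rightarrow> (nat \<Rightarrow> real^'x^'x) \<Rightarrow> (real^'x^'x) hypergraph" where
  "fusing_hypergraph d A =
     (A ` {1..d}, {A ` J |J. J \<subseteq> {1..d} \<and> card J = 3 \<and> fuses d A J})"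

end

theory Submission
  imports Defs
begin

text \<open>
  The span \<open>V\<close> of the matrices \<open>A i\<close> of a scheme is a commutative algebra of symmetric matrices,
  and multiplication in it is self-adjoint for the entrywise inner product. Let \<open>B i\<close> be the
  multiple of \<open>A i\<close> with \<open>A i \<bullet> B i = 1\<close>. The span of the fused relations of a partition consists
  of the matrices of \<open>V\<close> orthogonal to all differences \<open>B i - B j\<close> with \<open>i\<close>, \<open>j\<close> in one block, and
  the partition is a fusion iff this space is closed under multiplication
  (\<open>fusion_scheme_iff\<close>). Equivalently, the orthogonal complement of the space is stable under
  multiplication by the space. For a pair \<open>{i, j}\<close> this complement is the line of
  \<open>u = B i - B j\<close>: every element of \<open>V\<close> orthogonal to \<open>u\<close> must have \<open>u\<close> as an eigenvector
  (\<open>perp_eigen\<close>). If all pairs have this property, then so does every partition, and the scheme is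
  amorphic (\<open>amorphic_if_all_pairs\<close>).

  Two facts about an algebra of symmetric matrices drive the proof. Let \<open>x, y, z\<close> be independent,
  have equal nonzero mutual inner products, and have the eigenvector property. Then
  \<open>x y = y z = x z\<close>, and the differences \<open>x - y\<close> have the property as well (\<open>star_product\<close>,
  \<open>star_leaves\<close>). The vectors \<open>B c - B x\<close> for fixed \<open>c\<close> are of this kind, so three pairs
  \<open>{c, x}\<close>, \<open>{c, y}\<close>, \<open>{c, z}\<close> that fuse make \<open>{x, y}\<close> fuse.

  Consider a sunflower with core \<open>{a, b}\<close>, so that every \<open>{a, b, x}\<close> fuses, and put
  \<open>u = B a - B b\<close>. For a triple the complement is a plane. The planes of two triples
  \<open>{a, b, y}\<close> and \<open>{a, b, z}\<close> meet in the line of \<open>u\<close>, and this already makes \<open>{a, b}\<close> fuse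
  (\<open>perp_eigen_core\<close>). After merging \<open>a\<close> and \<open>b\<close> the remaining relations form a star around the
  merged one, so the star facts hold in the algebra of all matrices orthogonal to \<open>u\<close>. Passing
  from that algebra back to \<open>V\<close>, a pair \<open>{x, y}\<close> disjoint from \<open>{a, b}\<close> fuses as soon as
  \<open>B x\<close> and \<open>B y\<close> have the same product with \<open>u\<close> (\<open>perp_eigen_if_same_product\<close>).

  The second sunflower yields this equality. If its core \<open>{c, e}\<close> is disjoint from \<open>{a, b}\<close>, then
  \<open>u\<close> multiplies \<open>B x - B c\<close> into a plane that meets the line of \<open>u\<close> only in \<open>0\<close>. If it is
  \<open>{a, c}\<close>, then the eigenvalues \<open>t x\<close> of the star vectors on \<open>u\<close> satisfy \<open>t x t y = t x t z\<close>;
  they are all equal unless one of them vanishes at an index outside \<open>{a, b, c}\<close>, and in that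
  case the product rule of the second star turns into a cubic equation for \<open>u\<close>, which a nonzero
  symmetric matrix of trace \<open>0\<close> cannot satisfy (\<open>eq_zero_if_cubic\<close>). So all pairs outside each
  of the two cores fuse, and the star facts extend this to all pairs.
\<close>

section \<open>Commutative algebras of symmetric matrices\<close>

lemma bounded_bilinear_matrix_mult:
  "bounded_bilinear ((**) :: real^'n^'m \<Rightarrow> real^'p^'n \<Rightarrow> real^'p^'m)"
  by (intro bilinear_conv_bounded_bilinear[THEN iffD1])
    (auto simp: bilinear_def matrix_matrix_mult_def vec_eq_iff algebra_simps
      sum.distrib sum_distrib_left intro!: linearI)

interpretation matrix_mult:
  bounded_bilinear "(**) :: real^'n^'n \<Rightarrow> real^'n^'n \<Rightarrow> real^'n^'n"
  by (rule bounded_bilinear_matrix_mult)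

lemmas matrix_bilinear_simps =
  matrix_mult.add_left matrix_mult.add_right matrix_mult.diff_left matrix_mult.diff_right
  matrix_mult.scaleR_left matrix_mult.scaleR_right matrix_mult.minus_left matrix_mult.minus_right
  matrix_mult.zero_left matrix_mult.zero_right

lemma inner_matrix_mult_transpose:
  fixes X :: "real^'n^'m" and Y :: "real^'p^'n" and Z :: "real^'p^'m"
  shows "(X ** Y) \<bullet> Z = Y \<bullet> (transpose X ** Z)"
proof -
  have "(X ** Y) \<bullet> Z = (\<Sum>i\<in>UNIV. \<Sum>j\<in>UNIV. \<Sum>k\<in>UNIV. X$i$k * Y$k$j * Z$i$j)"
    by (simp add: inner_vec_def matrix_matrix_mult_def sum_distrib_right)
  also have "\<dots> = (\<Sum>i\<in>UNIV. \<Sum>k\<in>UNIV. \<Sum>j\<in>UNIV. X$i$k * Y$k$j * Z$i$j)"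
    by (intro sum.cong refl sum.swap)
  also have "\<dots> = (\<Sum>k\<in>UNIV. \<Sum>i\<in>UNIV. \<Sum>j\<in>UNIV. X$i$k * Y$k$j * Z$i$j)"
    by (rule sum.swap)
  also have "\<dots> = (\<Sum>k\<in>UNIV. \<Sum>j\<in>UNIV. \<Sum>i\<in>UNIV. X$i$k * Y$k$j * Z$i$j)"
    by (intro sum.cong refl sum.swap)
  also have "\<dots> = Y \<bullet> (transpose X ** Z)"
    by (simp add: inner_vec_def matrix_matrix_mult_def transpose_def sum_distrib_left mult_ac)
  finally show ?thesis .
qed

text \<open>
  The condition says that the line spanned by \<open>u\<close> is a module over its own orthogonal complement in
  \<open>V\<close>. By self-adjointness of multiplication this amounts to the complement being closed under
  multiplication, see \<open>perp_algebra\<close> below.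
\<close>

definition perp_eigen :: "(real^'n^'n) set \<Rightarrow> real^'n^'n \<Rightarrow> bool" where
  "perp_eigen V u \<longleftrightarrow> (\<forall>w\<in>V. w \<bullet> u = 0 \<longrightarrow> (\<exists>c. w ** u = c *\<^sub>R u))"

lemma perp_eigenD:
  assumes "perp_eigen V u" "w \<in> V" "w \<bullet> u = 0"
  obtains c where "w ** u = c *\<^sub>R u"
  using assms unfolding perp_eigen_def by blast

lemma perp_eigen_minus_commute: "perp_eigen V (x - y) \<longleftrightarrow> perp_eigen V (y - x)"
proof -
  have "perp_eigen V (- u)" if "perp_eigen V u" for u
    using that by (auto simp: perp_eigen_def matrix_bilinear_simps)
  from this[of "x - y"] this[of "y - x"] show ?thesis by auto
qed

locale symmetric_matrix_algebra =
  fixes V :: "(real^'n^'n) set"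
  assumes subspace_V: "subspace V"
    and one_in: "mat 1 \<in> V"
    and mult_in: "X \<in> V \<Longrightarrow> Y \<in> V \<Longrightarrow> X ** Y \<in> V"
    and transpose_eq: "X \<in> V \<Longrightarrow> transpose X = X"
begin

lemmas closed_intros =
  subspace_V[THEN subspace_add] subspace_V[THEN subspace_diff]
  subspace_V[THEN subspace_scale] subspace_V[THEN subspace_0] mult_in

lemma mult_commute: "X \<in> V \<Longrightarrow> Y \<in> V \<Longrightarrow> X ** Y = Y ** X"
  using transpose_eq[OF mult_in[of X Y]] by (simp add: matrix_transpose_mul transpose_eq)

lemma mult_left_commute:
  "X \<in> V \<Longrightarrow> Y \<in> V \<Longrightarrow> X ** (Y ** Z) = Y ** (X ** Z)"
  by (simp add: matrix_mul_assoc mult_commute)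

lemma inner_mult_left: "X \<in> V \<Longrightarrow> (X ** Y) \<bullet> Z = Y \<bullet> (X ** Z)"
  using inner_matrix_mult_transpose[of X Y Z] by (simp only: transpose_eq)

text \<open>The inner product is the trace of the product, and \<open>X \<bullet> mat 1\<close> is the trace of \<open>X\<close>.\<close>

lemma inner_eq_inner_one: "X \<in> V \<Longrightarrow> X \<bullet> Y = (X ** Y) \<bullet> mat 1"
  using inner_mult_left[of X Y "mat 1"] by (simp add: inner_commute)

lemma perp_algebra:
  assumes u: "u \<in> V" "mat 1 \<bullet> u = 0" "perp_eigen V u"
  shows "symmetric_matrix_algebra {w\<in>V. w \<bullet> u = 0}"
proof
  show "subspace {w\<in>V. w \<bullet> u = 0}"
    by (auto simp: subspace_def inner_add_left intro: closed_intros)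
  show "mat 1 \<in> {w\<in>V. w \<bullet> u = 0}" using one_in u by auto
  show "transpose X = X" if "X \<in> {w\<in>V. w \<bullet> u = 0}" for X using that transpose_eq by auto
  show "X ** Y \<in> {w\<in>V. w \<bullet> u = 0}" if XY: "X \<in> {w\<in>V. w \<bullet> u = 0}" "Y \<in> {w\<in>V. w \<bullet> u = 0}" for X Y
  proof -
    obtain c where "X ** u = c *\<^sub>R u" using XY u perp_eigenD by blast
    then show ?thesis using XY by (simp add: inner_mult_left mult_in)
  qed
qed

text \<open>
  Here \<open>y - z\<close> is orthogonal to \<open>x\<close> because the mutual inner products agree, so \<open>x (y - z)\<close> is a
  multiple of \<open>x\<close>; likewise for the other two vectors. These three products add up to \<open>0\<close>, hence by
  independence each of them is \<open>0\<close>, which gives the product rule. For the differences, a matrix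
  \<open>w\<close> orthogonal to \<open>x - y\<close> becomes orthogonal to both \<open>x\<close> and \<open>y\<close> after subtracting a multiple
  of \<open>z\<close>, and \<open>z\<close> itself annihilates \<open>x - y\<close>; the eigenvalues on \<open>x\<close> and \<open>y\<close> agree because both
  are the eigenvalue on \<open>x y\<close>, whose trace \<open>s\<close> is nonzero.
\<close>

lemma
  assumes V: "x \<in> V" "y \<in> V" "z \<in> V"
    and eig: "perp_eigen V x" "perp_eigen V y" "perp_eigen V z"
    and inner: "x \<bullet> y = s" "y \<bullet> z = s" "x \<bullet> z = s" "s \<noteq> 0"
    and indep: "\<And>p q r. p *\<^sub>R x + q *\<^sub>R y + r *\<^sub>R z = 0 \<Longrightarrow> p = 0 \<and> q = 0 \<and> r = 0"
  shows star_product: "x ** y = x ** z"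
    and star_leaves: "perp_eigen V (x - y)"
proof -
  have inner': "x \<bullet> y = s" "y \<bullet> z = s" "x \<bullet> z = s" "y \<bullet> x = s" "z \<bullet> y = s" "z \<bullet> x = s" "s \<noteq> 0"
    using inner by (auto simp: inner_commute)
  have "(y - z) \<bullet> x = 0" "(z - x) \<bullet> y = 0" "(x - y) \<bullet> z = 0"
    using inner' by (simp_all add: inner_diff_left)
  then obtain p q r where
    pqr: "(y - z) ** x = p *\<^sub>R x" "(z - x) ** y = q *\<^sub>R y" "(x - y) ** z = r *\<^sub>R z"
    using V eig closed_intros(2) by (meson perp_eigenD)
  have "p *\<^sub>R x + q *\<^sub>R y + r *\<^sub>R z = 0"
    unfolding pqr[symmetric] using V
    by (simp add: matrix_bilinear_simps mult_commute[of y x] mult_commute[of z x] mult_commute[of z y])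
  then have "p = 0" using indep by blast
  then show xyz: "x ** y = x ** z"
    using pqr(1) V by (simp add: matrix_bilinear_simps mult_commute[of y x] mult_commute[of z x])
  have "q = 0" using indep[OF \<open>p *\<^sub>R x + q *\<^sub>R y + r *\<^sub>R z = 0\<close>] by blast
  then have zxy: "z ** x = z ** y"
    using pqr(2) V xyz by (simp add: matrix_bilinear_simps mult_commute[of z x] mult_commute[of z y])
  show "perp_eigen V (x - y)"
    unfolding perp_eigen_def
  proof (intro ballI impI)
    fix w assume w: "w \<in> V" "w \<bullet> (x - y) = 0"
    define m where "m = (w \<bullet> x) / s"
    have "(w - m *\<^sub>R z) \<bullet> x = 0" "(w - m *\<^sub>R z) \<bullet> y = 0"
      using w inner' by (simp_all add: m_def inner_diff_left inner_diff_right inner_commute)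
    moreover have "w - m *\<^sub>R z \<in> V" using w V by (intro closed_intros)
    ultimately obtain c c' where
      c: "(w - m *\<^sub>R z) ** x = c *\<^sub>R x" and c': "(w - m *\<^sub>R z) ** y = c' *\<^sub>R y"
      using eig by (meson perp_eigenD)
    have "c *\<^sub>R (x ** y) = (w - m *\<^sub>R z) ** (x ** y)"
      by (metis c matrix_mul_assoc matrix_mult.scaleR_left)
    also have "\<dots> = x ** ((w - m *\<^sub>R z) ** y)"
      using V \<open>w - m *\<^sub>R z \<in> V\<close> by (simp add: mult_left_commute)
    also have "\<dots> = c' *\<^sub>R (x ** y)" by (simp only: c' matrix_mult.scaleR_right)
    finally have "c = c' \<or> x ** y = 0" by simp
    moreover have "x ** y \<noteq> 0" using inner inner_eq_inner_one[of x y] V by auto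
    ultimately have "c = c'" by simp
    then have "w ** (x - y) = c *\<^sub>R (x - y)"
      using c c' zxy by (simp add: matrix_bilinear_simps algebra_simps)
    then show "\<exists>c. w ** (x - y) = c *\<^sub>R (x - y)" ..
  qed
qed

text \<open>
  A symmetric matrix is diagonalizable, so the cubic equation forces \<open>u ** u = q *\<^sub>R u\<close>. Then all
  nonzero eigenvalues equal \<open>q\<close>, and the trace is \<open>0\<close> only if there are none. The proof reads this
  off from the inner products among \<open>u\<close> and \<open>u ** u\<close>.
\<close>

lemma eq_zero_if_cubic:
  assumes u: "u \<in> V" "mat 1 \<bullet> u = 0" and cube: "u ** (u ** u) = q *\<^sub>R (u ** u)"
  shows "u = 0"
proof -
  have 1: "(u ** u) \<bullet> u = q * (u \<bullet> u)"
    using arg_cong[OF cube, of "\<lambda>X. X \<bullet> mat 1"]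
      inner_mult_left[OF u(1), of "u ** u" "mat 1"] inner_mult_left[OF u(1), of u "mat 1"] by simp
  have 2: "(u ** u) \<bullet> (u ** u) = q * (q * (u \<bullet> u))"
    using arg_cong[OF cube, of "\<lambda>X. X \<bullet> u"] inner_mult_left[OF u(1), of "u ** u" u] 1 by simp
  have "(u ** u - q *\<^sub>R u) \<bullet> (u ** u - q *\<^sub>R u) = 0"
    using 1 2 by (simp add: inner_diff_left inner_diff_right inner_commute algebra_simps)
  then have "u ** u = q *\<^sub>R u" by simp
  then have "u \<bullet> u = q * (u \<bullet> mat 1)"
    using u(1) by (metis inner_eq_inner_one inner_scaleR_left)
  then show ?thesis using u by (simp add: inner_commute)
qed

end


section \<open>Fusions as subalgebras of the Bose-Mesner algebra\<close>

locale scheme =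
  fixes d :: nat and A :: "nat \<Rightarrow> real^'x^'x"
  assumes scheme: "symmetric_scheme {0..d} 0 A"
begin

lemma A_inner_pos: "i \<le> d \<Longrightarrow> A i \<bullet> A i > 0"
  using scheme by (simp add: symmetric_scheme_def)

text \<open>The supports are disjoint, as the 0/1 matrices sum up to the all-one matrix.\<close>

lemma A_inner_A_distinct:
  assumes "i \<le> d" "j \<le> d" "i \<noteq> j"
  shows "A i \<bullet> A j = 0"
proof -
  have 01: "A h $ x $ y = 0 \<or> A h $ x $ y = 1" if "h \<le> d" for h x y
    using scheme that by (auto simp: symmetric_scheme_def)
  have zero: "A i $ x $ y * A j $ x $ y = 0" for x y
  proof -
    have "A i $ x $ y + A j $ x $ y = (\<Sum>h\<in>{i, j}. A h $ x $ y)" using assms by simp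
    also have "\<dots> \<le> (\<Sum>h\<in>{0..d}. A h $ x $ y)"
    proof (rule sum_mono2)
      show "0 \<le> A h $ x $ y" if "h \<in> {0..d} - {i, j}" for h using 01[of h x y] that by auto
    qed (use assms in auto)
    also have "\<dots> = (\<Sum>h\<in>{0..d}. A h) $ x $ y" by simp
    also have "\<dots> = 1" using scheme by (simp add: symmetric_scheme_def)
    finally show ?thesis using 01[OF assms(1), of x y] 01[OF assms(2), of x y] by auto
  qed
  show ?thesis unfolding inner_vec_def inner_real_def by (intro sum.neutral ballI zero)
qed

text \<open>
  As the entries are 0 and 1, this is the number of ones in \<open>A i\<close>, which is the valency of the
  relation times the number of points.
\<close>

definition weight :: "nat \<Rightarrow> real" where
  "weight i = A i \<bullet> A i"

lemma weight_pos: "i \<le> d \<Longrightarrow> weight i > 0"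
  using A_inner_pos by (simp add: weight_def)

lemma weight_nonzero: "i \<le> d \<Longrightarrow> weight i \<noteq> 0"
  using weight_pos[of i] by simp

text \<open>The Bose-Mesner algebra of the scheme.\<close>

definition V :: "(real^'x^'x) set" where
  "V = span (A ` {0..d})"

text \<open>
  This is the basis of \<open>V\<close> dual to \<open>A\<close>: the number \<open>X \<bullet> B i\<close> is the coefficient of \<open>A i\<close> in
  \<open>X\<close>, and \<open>X \<bullet> A i\<close> is that of \<open>B i\<close>.
\<close>

definition B :: "nat \<Rightarrow> real^'x^'x" where
  "B i = A i /\<^sub>R weight i"

lemma A_in: "i \<le> d \<Longrightarrow> A i \<in> V"
  unfolding V_def by (rule span_base) auto

lemma A_inner_B: "i \<le> d \<Longrightarrow> j \<le> d \<Longrightarrow> A i \<bullet> B j = of_bool (i = j)"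
  using weight_nonzero[of i] A_inner_A_distinct[of i j] by (auto simp: B_def weight_def[symmetric])

lemma B_inner_A: "i \<le> d \<Longrightarrow> j \<le> d \<Longrightarrow> B i \<bullet> A j = of_bool (i = j)"
  using A_inner_B[of j i] by (auto simp: inner_commute)

lemma B_inner_B: "i \<le> d \<Longrightarrow> j \<le> d \<Longrightarrow> B i \<bullet> B j = of_bool (i = j) / weight i"
  using A_inner_B[of i j] by (auto simp: B_def[of i] divide_inverse)

lemma subspace_span_A: "subspace V" by (simp add: V_def)

lemma B_in: "i \<le> d \<Longrightarrow> B i \<in> V"
  unfolding B_def by (intro subspace_scale subspace_span_A A_in)

lemma expand_A:
  assumes "X \<in> V"
  shows "X = (\<Sum>h\<in>{0..d}. (X \<bullet> B h) *\<^sub>R A h)"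
proof -
  have "V \<subseteq> {X. X = (\<Sum>h\<in>{0..d}. (X \<bullet> B h) *\<^sub>R A h)}"
    unfolding V_def
  proof (rule span_minimal)
    show "A ` {0..d} \<subseteq> {X. X = (\<Sum>h\<in>{0..d}. (X \<bullet> B h) *\<^sub>R A h)}"
    proof clarsimp
      fix i assume "i \<le> d"
      then have "(\<Sum>h\<in>{0..d}. (A i \<bullet> B h) *\<^sub>R A h) = (\<Sum>h\<in>{0..d}. if h = i then A i else 0)"
        by (intro sum.cong) (auto simp: A_inner_B)
      then show "A i = (\<Sum>h\<in>{0..d}. (A i \<bullet> B h) *\<^sub>R A h)" using \<open>i \<le> d\<close> by simp
    qed
    show "subspace {X. X = (\<Sum>h\<in>{0..d}. (X \<bullet> B h) *\<^sub>R A h)}"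
      by (auto simp: subspace_def inner_add_left scaleR_add_left sum.distrib
          simp flip: scaleR_scaleR scaleR_sum_right)
  qed
  then show ?thesis using assms by auto
qed

lemma eq_if_inner_A_eq:
  assumes "X \<in> V" "Y \<in> V" "\<And>h. h \<le> d \<Longrightarrow> X \<bullet> A h = Y \<bullet> A h"
  shows "X = Y"
proof -
  have "X \<bullet> B h = Y \<bullet> B h" if "h \<le> d" for h using assms(3)[OF that] by (simp add: B_def)
  then show ?thesis by (subst expand_A[OF assms(1)], subst expand_A[OF assms(2)]) simp
qed

lemma algebra_V: "symmetric_matrix_algebra V"
proof
  show "subspace V" by (rule subspace_span_A)
  have "A 0 = mat 1" using scheme by (simp add: symmetric_scheme_def)
  then show "mat 1 \<in> V" using A_in[of 0] by simp
  have "V \<subseteq> {X. transpose X = X}"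
    unfolding V_def
  proof (rule span_minimal)
    show "A ` {0..d} \<subseteq> {X. transpose X = X}"
      using scheme unfolding symmetric_scheme_def by blast
    show "subspace {X :: real^'x^'x. transpose X = X}"
      by (simp add: subspace_def transpose_def vec_eq_iff)
  qed
  then show "transpose X = X" if "X \<in> V" for X using that by blast
  have AA: "A i ** A j \<in> V" if "i \<le> d" "j \<le> d" for i j
  proof -
    have "i \<in> {0..d}" "j \<in> {0..d}" using that by auto
    then obtain p :: "nat \<Rightarrow> nat \<Rightarrow> nat \<Rightarrow> real" where
      "A i ** A j = (\<Sum>h\<in>{0..d}. p i j h *\<^sub>R A h)"
      using scheme unfolding symmetric_scheme_def by blast
    also have "\<dots> \<in> V" by (intro subspace_sum subspace_scale subspace_span_A A_in) auto
    finally show ?thesis .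
  qed
  show "X ** Y \<in> V" if "X \<in> V" "Y \<in> V" for X Y
  proof -
    have "X ** Y = (\<Sum>i\<in>{0..d}. (X \<bullet> B i) *\<^sub>R A i) ** (\<Sum>j\<in>{0..d}. (Y \<bullet> B j) *\<^sub>R A j)"
      by (simp only: expand_A[OF that(1), symmetric] expand_A[OF that(2), symmetric])
    also have "\<dots> \<in> V"
      unfolding matrix_mult.sum_left matrix_mult.sum_right matrix_bilinear_simps
      by (intro subspace_sum subspace_scale subspace_span_A AA) auto
    finally show ?thesis .
  qed
qed

sublocale symmetric_matrix_algebra V by (rule algebra_V)

text \<open>
  The span of the fused relations of \<open>P\<close>, described by its orthogonality relations because in this
  form fusions can be compared with lines \<open>B i - B j\<close>.
\<close>

definition block_constant :: "nat set set \<Rightarrow> (real^'x^'x) set" where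
  "block_constant P = {X\<in>V. \<forall>C\<in>P. \<forall>i\<in>C. \<forall>j\<in>C. X \<bullet> B i = X \<bullet> B j}"

lemma block_constant_in: "X \<in> block_constant P \<Longrightarrow> X \<in> V"
  unfolding block_constant_def by blast

lemma block_constantD:
  "X \<in> block_constant P \<Longrightarrow> C \<in> P \<Longrightarrow> i \<in> C \<Longrightarrow> j \<in> C \<Longrightarrow> X \<bullet> B i = X \<bullet> B j"
  unfolding block_constant_def by blast

lemma block_constantI:
  "X \<in> V \<Longrightarrow> (\<And>C i j. C \<in> P \<Longrightarrow> i \<in> C \<Longrightarrow> j \<in> C \<Longrightarrow> X \<bullet> B i = X \<bullet> B j) \<Longrightarrow> X \<in> block_constant P"
  unfolding block_constant_def by blast

lemma block_sum_in_block_constant: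
  assumes "partition_on {0..d} P" "C \<in> P"
  shows "(\<Sum>i\<in>C. A i) \<in> block_constant P"
proof -
  have sub: "D \<subseteq> {0..d}" if "D \<in> P" for D using assms(1) that by (auto simp: partition_on_def)
  have fin: "finite C" using finite_subset[OF sub[OF assms(2)]] by simp
  have inn: "(\<Sum>i\<in>C. A i) \<bullet> B j = of_bool (j \<in> C)" if "j \<le> d" for j
  proof -
    have "(\<Sum>i\<in>C. A i) \<bullet> B j = (\<Sum>i\<in>C. if i = j then 1 else 0)"
      unfolding inner_sum_left using sub[OF assms(2)] that
      by (intro sum.cong refl) (auto simp: A_inner_B subset_iff)
    then show ?thesis using fin by simp
  qed
  have "(\<Sum>i\<in>C. A i) \<bullet> B i = (\<Sum>i\<in>C. A i) \<bullet> B j" if "D \<in> P" "i \<in> D" "j \<in> D" for D i j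
  proof -
    have "i \<in> C \<longleftrightarrow> j \<in> C"
      using partition_onD2[OF assms(1)] assms(2) that by (auto simp: disjoint_def)
    moreover have "i \<le> d" "j \<le> d" using sub[OF that(1)] that by auto
    ultimately show ?thesis by (simp add: inn)
  qed
  moreover have "(\<Sum>i\<in>C. A i) \<in> V"
    using sub[OF assms(2)] by (intro subspace_sum subspace_span_A A_in) auto
  ultimately show ?thesis unfolding block_constant_def by blast
qed

lemma block_constant_expand:
  assumes "partition_on {0..d} P" "X \<in> block_constant P"
  obtains c where "X = (\<Sum>C\<in>P. c C *\<^sub>R (\<Sum>i\<in>C. A i))"
proof
  have fin: "\<forall>C\<in>P. finite C"
    using assms(1) by (metis partition_on_def Sup_upper finite_atLeastAtMost finite_subset)
  have disj: "\<forall>C\<in>P. \<forall>D\<in>P. C \<noteq> D \<longrightarrow> C \<inter> D = {}"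
    using partition_onD2[OF assms(1)] by (auto simp: disjoint_def)
  have "X = (\<Sum>h\<in>\<Union>P. (X \<bullet> B h) *\<^sub>R A h)"
    using expand_A[of X] assms by (simp add: block_constant_def partition_on_def)
  also have "\<dots> = (\<Sum>C\<in>P. \<Sum>h\<in>C. (X \<bullet> B h) *\<^sub>R A h)"
    using sum.Union_disjoint[OF fin disj] by simp
  also have "\<dots> = (\<Sum>C\<in>P. (X \<bullet> B (SOME i. i \<in> C)) *\<^sub>R (\<Sum>h\<in>C. A h))"
    unfolding scaleR_sum_right
  proof (intro sum.cong refl)
    fix C h assume C: "C \<in> P" "h \<in> C"
    then have "(SOME i. i \<in> C) \<in> C" by (auto intro: someI)
    then have "X \<bullet> B h = X \<bullet> B (SOME i. i \<in> C)"
      using C assms(2) unfolding block_constant_def by blast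
    then show "(X \<bullet> B h) *\<^sub>R A h = (X \<bullet> B (SOME i. i \<in> C)) *\<^sub>R A h" by simp
  qed
  finally show "X = (\<Sum>C\<in>P. (X \<bullet> B (SOME i. i \<in> C)) *\<^sub>R (\<Sum>i\<in>C. A i))" .
qed

lemma subspace_block_constant: "subspace (block_constant P)"
proof -
  have "block_constant P = V \<inter> (\<Inter>C\<in>P. \<Inter>i\<in>C. \<Inter>j\<in>C. {X. (B i - B j) \<bullet> X = 0})"
    by (auto simp: block_constant_def inner_commute[of "B i - B j" for i j] inner_diff_right)
  then show ?thesis
    by (auto intro!: subspace_inter subspace_V subspace_Inter subspace_hyperplane)
qed

lemma fusion_scheme_iff:
  assumes P: "partition_on {0..d} P" "{0} \<in> P"
  shows "fusion_scheme d A P \<longleftrightarrow>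
    (\<forall>X\<in>block_constant P. \<forall>Y\<in>block_constant P. X ** Y \<in> block_constant P)"
proof
  assume "fusion_scheme d A P"
  then obtain p :: "nat set \<Rightarrow> nat set \<Rightarrow> nat set \<Rightarrow> real" where
    p: "\<And>C D. C \<in> P \<Longrightarrow> D \<in> P \<Longrightarrow>
      (\<Sum>i\<in>C. A i) ** (\<Sum>i\<in>D. A i) = (\<Sum>h\<in>P. p C D h *\<^sub>R (\<Sum>i\<in>h. A i))"
    unfolding fusion_scheme_def symmetric_scheme_def by blast
  show "\<forall>X\<in>block_constant P. \<forall>Y\<in>block_constant P. X ** Y \<in> block_constant P"
  proof (intro ballI)
    fix X Y assume XY: "X \<in> block_constant P" "Y \<in> block_constant P"
    obtain c where c: "X = (\<Sum>C\<in>P. c C *\<^sub>R (\<Sum>i\<in>C. A i))"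
      using block_constant_expand[OF P(1) XY(1)] .
    obtain e where e: "Y = (\<Sum>C\<in>P. e C *\<^sub>R (\<Sum>i\<in>C. A i))"
      using block_constant_expand[OF P(1) XY(2)] .
    have "(\<Sum>i\<in>C. A i) ** (\<Sum>i\<in>D. A i) \<in> block_constant P" if "C \<in> P" "D \<in> P" for C D
      unfolding p[OF that]
      by (intro subspace_sum subspace_scale subspace_block_constant block_sum_in_block_constant P)
    then show "X ** Y \<in> block_constant P"
      unfolding c e matrix_mult.sum_left[of _ P] matrix_mult.sum_right[of _ _ P]
        matrix_mult.scaleR_left matrix_mult.scaleR_right
      by (intro subspace_sum subspace_scale subspace_block_constant)
  qed
next
  assume closed: "\<forall>X\<in>block_constant P. \<forall>Y\<in>block_constant P. X ** Y \<in> block_constant P"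
  have sub: "C \<subseteq> {0..d}" if "C \<in> P" for C using P(1) that by (auto simp: partition_on_def)
  have fin: "finite C" if "C \<in> P" for C using finite_subset[OF sub[OF that]] by simp
  have disj: "\<forall>C\<in>P. \<forall>D\<in>P. C \<noteq> D \<longrightarrow> C \<inter> D = {}"
    using partition_onD2[OF P(1)] by (auto simp: disjoint_def)
  have "finite P" using P(1) by (metis finite_atLeastAtMost finite_elements)
  moreover have "(\<Sum>i\<in>C. A i) \<noteq> 0" if "C \<in> P" for C
  proof
    assume 0: "(\<Sum>i\<in>C. A i) = 0"
    have "C \<noteq> {}" using partition_onD3[OF P(1)] that by auto
    then obtain j where j: "j \<in> C" by blast
    have "A j \<bullet> A j \<le> (\<Sum>i\<in>C. A i \<bullet> A j)"
      using sub[OF that] j A_inner_A_distinct A_inner_pos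
      by (intro member_le_sum fin that) (auto simp: subset_iff)
    also have "\<dots> = (\<Sum>i\<in>C. A i) \<bullet> A j" by (simp add: inner_sum_left)
    also have "\<dots> = 0" using 0 by simp
    finally have "A j \<bullet> A j \<le> 0" .
    moreover have "j \<le> d" using sub[OF that] j by auto
    ultimately show False by (metis A_inner_pos not_less)
  qed
  moreover have "(\<Sum>i\<in>C. A i) $ x $ y \<in> {0, 1}" if "C \<in> P" for C x y
  proof -
    have 01: "A h $ x $ y = 0 \<or> A h $ x $ y = 1" if "h \<le> d" for h
      using scheme that by (auto simp: symmetric_scheme_def)
    have int: "(\<Sum>i\<in>C. A i $ x $ y) \<in> \<int>"
      using sub[OF that] 01 by (intro Ints_sum) (metis Ints_0 Ints_1 atLeastAtMost_iff subsetD)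
    have "0 \<le> (\<Sum>i\<in>C. A i $ x $ y)" using sub[OF that] 01 by (intro sum_nonneg) force
    moreover have "(\<Sum>i\<in>C. A i $ x $ y) \<le> (\<Sum>i\<in>{0..d}. A i $ x $ y)"
    proof (rule sum_mono2)
      show "0 \<le> A h $ x $ y" if "h \<in> {0..d} - C" for h using 01[of h] that by auto
    qed (use sub[OF that] in auto)
    moreover have "(\<Sum>i\<in>{0..d}. A i $ x $ y) = (\<Sum>i\<in>{0..d}. A i) $ x $ y" by simp
    moreover have "\<dots> = 1" using scheme by (simp add: symmetric_scheme_def)
    ultimately have "0 \<le> (\<Sum>i\<in>C. A i $ x $ y)" "(\<Sum>i\<in>C. A i $ x $ y) \<le> 1" by linarith+
    moreover obtain n where "(\<Sum>i\<in>C. A i $ x $ y) = of_int n" using int by (elim Ints_cases)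
    ultimately have "n = 0 \<or> n = 1" "(\<Sum>i\<in>C. A i $ x $ y) = of_int n" by auto
    then show ?thesis by auto
  qed
  moreover have "(\<Sum>i\<in>{0}. A i) = mat 1" using scheme by (simp add: symmetric_scheme_def)
  moreover have "(\<Sum>C\<in>P. \<Sum>i\<in>C. A i) = (\<chi> x y. 1)"
  proof -
    have "(\<Sum>C\<in>P. \<Sum>i\<in>C. A i) = sum A (\<Union>P)"
      using sum.Union_disjoint[of P A] fin disj by simp
    then show ?thesis using P(1) scheme by (simp add: symmetric_scheme_def partition_on_def)
  qed
  moreover have "transpose (\<Sum>i\<in>C. A i) = (\<Sum>i\<in>C. A i)" if "C \<in> P" for C
    using block_sum_in_block_constant[OF P(1) that] transpose_eq by (simp add: block_constant_def)
  moreover have "\<exists>p. \<forall>C\<in>P. \<forall>D\<in>P. (\<Sum>i\<in>C. A i) ** (\<Sum>i\<in>D. A i)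
      = (\<Sum>h\<in>P. p C D h *\<^sub>R (\<Sum>i\<in>h. A i))"
  proof -
    have "\<exists>c. (\<Sum>i\<in>C. A i) ** (\<Sum>i\<in>D. A i) = (\<Sum>h\<in>P. c h *\<^sub>R (\<Sum>i\<in>h. A i))"
      if "C \<in> P" "D \<in> P" for C D
      using closed block_sum_in_block_constant[OF P(1)] that block_constant_expand[OF P(1)] by meson
    then show ?thesis by metis
  qed
  ultimately show "fusion_scheme d A P"
    using P unfolding fusion_scheme_def symmetric_scheme_def by blast
qed

text \<open>
  The space of a partition is the intersection of the complements of the lines \<open>B i - B j\<close> with
  \<open>i\<close>, \<open>j\<close> in one block, and an intersection of subalgebras is a subalgebra. The hypothesis covers all
  pairs that occur, since the blocks other than \<open>{0}\<close> lie in \<open>{1..d}\<close>.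
\<close>

lemma amorphic_if_all_pairs:
  assumes "\<And>i j. i \<in> {1..d} \<Longrightarrow> j \<in> {1..d} \<Longrightarrow> i \<noteq> j \<Longrightarrow> perp_eigen V (B i - B j)"
  shows "amorphic d A"
  unfolding amorphic_def
proof (intro allI impI, elim conjE)
  fix P assume P: "partition_on {0..d} P" "{0} \<in> P"
  have eq: "(X ** Y) \<bullet> B i = (X ** Y) \<bullet> B j"
    if X: "X \<in> block_constant P" and Y: "Y \<in> block_constant P" and C: "C \<in> P" "i \<in> C" "j \<in> C"
    for X Y C i j
  proof (cases "i = j")
    case False
    have "C \<noteq> {0}" using False C by auto
    then have "0 \<notin> C" using disjointD[OF partition_onD2[OF P(1)] C(1) P(2)] by auto
    moreover have "C \<subseteq> {0..d}" using P(1) C(1) by (auto simp: partition_on_def)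
    ultimately have "i \<in> {1..d}" "j \<in> {1..d}" using C by (auto simp: Suc_le_eq intro: gr0I)
    then have "perp_eigen V (B i - B j)" using assms False by blast
    moreover have XV: "X \<in> V" "X \<bullet> (B i - B j) = 0"
      using block_constantD[OF X C] block_constant_in[OF X] by (simp_all add: inner_diff_right)
    ultimately obtain c where c: "X ** (B i - B j) = c *\<^sub>R (B i - B j)" by (rule perp_eigenD)
    have "(X ** Y) \<bullet> (B i - B j) = c * (Y \<bullet> (B i - B j))" using XV by (simp add: inner_mult_left c)
    moreover have "Y \<bullet> (B i - B j) = 0"
      using block_constantD[OF Y C] by (simp add: inner_diff_right)
    ultimately show ?thesis by (simp add: inner_diff_right)
  qed simp
  show "fusion_scheme d A P"
    unfolding fusion_scheme_iff[OF P]
  proof (intro ballI block_constantI)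
    fix X Y assume "X \<in> block_constant P" "Y \<in> block_constant P"
    then show "X ** Y \<in> V" by (intro mult_in) (auto dest: block_constant_in)
  qed (rule eq)
qed


text \<open>
  This is the space \<open>block_constant P\<close> for the partition \<open>P\<close> with block \<open>J\<close> and singletons.
\<close>

definition constant_across :: "nat set \<Rightarrow> (real^'x^'x) set" where
  "constant_across J = {X\<in>V. \<forall>i\<in>J. \<forall>j\<in>J. X \<bullet> B i = X \<bullet> B j}"

lemma constant_across_in: "X \<in> constant_across J \<Longrightarrow> X \<in> V"
  unfolding constant_across_def by blast

lemma constant_acrossI:
  "X \<in> V \<Longrightarrow> (\<And>i. i \<in> J \<Longrightarrow> X \<bullet> B i = c) \<Longrightarrow> X \<in> constant_across J"
  unfolding constant_across_def by auto

lemma A_in_constant_across: "h \<le> d \<Longrightarrow> h \<notin> J \<Longrightarrow> J \<subseteq> {1..d} \<Longrightarrow> A h \<in> constant_across J"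
  by (auto simp: constant_across_def A_in A_inner_B subset_iff)

text \<open>
  The complement of \<open>constant_across J\<close> consists of the combinations of the \<open>B h\<close> with \<open>h \<in> J\<close> and
  coefficient sum \<open>0\<close>. When \<open>J\<close> fuses, this complement is a module over \<open>constant_across J\<close>; the two
  conclusions say so in coordinates.
\<close>

lemma
  assumes J: "fuses d A J" and w: "w \<in> constant_across J" and ij: "i \<in> J" "j \<in> J"
  shows fuses_module: "h \<le> d \<Longrightarrow> h \<notin> J \<Longrightarrow> (w ** (B i - B j)) \<bullet> A h = 0"
    and fuses_module_sum: "(w ** (B i - B j)) \<bullet> (\<Sum>h\<in>J. A h) = 0"
proof -
  let ?P = "insert J ((\<lambda>i. {i}) ` ({0..d} - J))"
  have sub: "J \<subseteq> {1..d}" and P: "partition_on {0..d} ?P" "{0} \<in> ?P" and "fusion_scheme d A ?P"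
    using J unfolding fuses_def fusion_scheme_def by auto
  have eq: "block_constant ?P = constant_across J"
    unfolding block_constant_def constant_across_def by auto
  have closed: "X ** Y \<in> constant_across J" if "X \<in> constant_across J" "Y \<in> constant_across J" for X Y
    using fusion_scheme_iff[OF P] \<open>fusion_scheme d A ?P\<close> that unfolding eq by blast
  have perp: "(w ** (B i - B j)) \<bullet> g = 0" if "g \<in> constant_across J" for g
  proof -
    have "(w ** (B i - B j)) \<bullet> g = (w ** g) \<bullet> B i - (w ** g) \<bullet> B j"
      using constant_across_in[OF w] by (simp add: inner_mult_left inner_diff_left inner_diff_right
          matrix_mult.diff_right inner_commute)
    moreover have "(w ** g) \<bullet> B i = (w ** g) \<bullet> B j"
      using closed[OF w that] ij unfolding constant_across_def by blast
    ultimately show ?thesis by simp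
  qed
  show "(w ** (B i - B j)) \<bullet> A h = 0" if "h \<le> d" "h \<notin> J"
    by (intro perp A_in_constant_across sub that)
  show "(w ** (B i - B j)) \<bullet> (\<Sum>h\<in>J. A h) = 0"
    using perp block_sum_in_block_constant[OF P(1), of J] eq by auto
qed

section \<open>The core of a sunflower fuses\<close>

definition core_pair :: "nat \<Rightarrow> nat \<Rightarrow> bool" where
  "core_pair a b \<longleftrightarrow> a \<in> {1..d} \<and> b \<in> {1..d} \<and> a \<noteq> b \<and>
     (\<forall>x\<in>{1..d} - {a, b}. fuses d A {a, b, x})"

lemma core_pair_commute: "core_pair a b \<longleftrightarrow> core_pair b a"
  by (auto simp: core_pair_def insert_commute)

lemma core_pair_le: "core_pair a b \<Longrightarrow> a \<le> d \<and> b \<le> d \<and> a \<noteq> b"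
  by (simp add: core_pair_def)

lemma one_outside:
  assumes "finite F" "card F < d"
  obtains x where "x \<in> {1..d}" "x \<notin> F"
proof -
  have "\<not> {1..d} \<subseteq> F" using card_mono[OF assms(1), of "{1..d}"] assms(2) by auto
  then show ?thesis using that by blast
qed

lemma two_outside:
  assumes "finite F" "Suc (card F) < d"
  obtains x y where "x \<in> {1..d}" "x \<notin> F" "y \<in> {1..d}" "y \<notin> F" "x \<noteq> y"
proof -
  obtain x where x: "x \<in> {1..d}" "x \<notin> F" using one_outside[of F] assms by auto
  obtain y where "y \<in> {1..d}" "y \<notin> insert x F" using one_outside[of "insert x F"] assms x by auto
  then show ?thesis using that x by auto
qed

text \<open>
  A matrix that is constant across both \<open>{a, b, y}\<close> and \<open>{a, b, z}\<close> multiplies \<open>u\<close> into the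
  intersection of two planes, which is the line of \<open>u\<close>. Each \<open>A x\<close> with \<open>x\<close> outside \<open>{a, b}\<close> is
  of this kind, by choosing \<open>y\<close> and \<open>z\<close> different from \<open>x\<close>; there \<open>5 \<le> d\<close> enters. So is the
  all-one matrix, and together these matrices span the complement of \<open>u\<close>.
\<close>

lemma perp_eigen_core:
  assumes "5 \<le> d" and core: "core_pair a b"
  shows "perp_eigen V (B a - B b)"
proof -
  define u where "u = B a - B b"
  note ab = core_pair_le[OF core]
  have u_A: "u \<bullet> A h = of_bool (a = h) - of_bool (b = h)" if "h \<le> d" for h
    using ab that by (simp add: u_def inner_diff_left B_inner_A)
  have u_in: "u \<in> V" using ab by (simp add: u_def closed_intros B_in)
  define E where "E = {w\<in>V. \<exists>c. w ** u = c *\<^sub>R u}"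
  have subspace_E: "subspace E"
    unfolding subspace_def E_def
    by (auto simp: matrix_bilinear_simps intro: closed_intros exI[of _ 0])
      (rule exI, rule scaleR_add_left[symmetric])
  \<comment> \<open>Coordinates of \<open>w ** u\<close> outside \<open>{a, b}\<close> vanish: each such index lies outside one of the triples.\<close>
  have in_E: "w \<in> E"
    if w: "w \<in> constant_across {a, b, y}" "w \<in> constant_across {a, b, z}"
      and yz: "y \<in> {1..d} - {a, b}" "z \<in> {1..d} - {a, b}" "y \<noteq> z" for w y z
  proof -
    have fus: "fuses d A {a, b, y}" "fuses d A {a, b, z}"
      using core yz unfolding core_pair_def by blast+
    have zero: "(w ** u) \<bullet> A h = 0" if "h \<le> d" "h \<noteq> a" "h \<noteq> b" for h
      using fuses_module[OF fus(1) w(1), of a b h] fuses_module[OF fus(2) w(2), of a b h] that yz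
      unfolding u_def by auto
    have "(w ** u) \<bullet> (A a + (A b + A y)) = 0"
      using fuses_module_sum[OF fus(1) w(1), of a b] ab yz unfolding u_def by simp
    then have b: "(w ** u) \<bullet> A b = - ((w ** u) \<bullet> A a)"
      using zero[of y] yz by (simp add: inner_add_right)
    have w_in: "w \<in> V" using constant_across_in[OF w(1)] .
    have "w ** u = ((w ** u) \<bullet> A a) *\<^sub>R u"
    proof (rule eq_if_inner_A_eq)
      show "w ** u \<in> V" "((w ** u) \<bullet> A a) *\<^sub>R u \<in> V" by (intro closed_intros w_in u_in)+
      show "(w ** u) \<bullet> A h = (((w ** u) \<bullet> A a) *\<^sub>R u) \<bullet> A h" if "h \<le> d" for h
        using zero[OF that] b u_A[OF that] ab by auto
    qed
    then show ?thesis using w_in unfolding E_def by blast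
  qed
  have A_in_E: "A x \<in> E" if x: "x \<le> d" "x \<noteq> a" "x \<noteq> b" for x
  proof -
    obtain y z where yz: "y \<in> {1..d}" "y \<notin> {a, b, x}" "z \<in> {1..d}" "z \<notin> {a, b, x}" "y \<noteq> z"
      by (rule two_outside[of "{a, b, x}"]) (use \<open>5 \<le> d\<close> in \<open>auto simp: card_insert_if\<close>)
    have "a \<in> {1..d}" "b \<in> {1..d}" using core by (simp_all add: core_pair_def)
    then have "A x \<in> constant_across {a, b, y}" "A x \<in> constant_across {a, b, z}"
      using x yz by (blast intro: A_in_constant_across)+
    then show ?thesis using yz by (intro in_E[of _ y z]) auto
  qed
  \<comment> \<open>The all-one matrix stands in for \<open>A a + A b\<close>, from which it differs by a sum of other \<open>A x\<close>.\<close>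
  define J where "J = (\<Sum>h\<in>{0..d}. A h)"
  have J_B: "J \<bullet> B i = 1" if "i \<le> d" for i
  proof -
    have "J \<bullet> B i = (\<Sum>h\<in>{0..d}. if h = i then 1 else 0)"
      unfolding J_def inner_sum_left using that by (intro sum.cong) (auto simp: A_inner_B)
    then show ?thesis using that by simp
  qed
  have J_in_E: "J \<in> E"
  proof -
    obtain y z where yz: "y \<in> {1..d}" "y \<notin> {a, b}" "z \<in> {1..d}" "z \<notin> {a, b}" "y \<noteq> z"
      by (rule two_outside[of "{a, b}"]) (use \<open>5 \<le> d\<close> in \<open>auto simp: card_insert_if\<close>)
    have "J \<in> V" unfolding J_def by (intro subspace_sum subspace_V A_in) auto
    then have "J \<in> constant_across {a, b, h}" if "h \<in> {1..d}" for h
      using J_B ab that by (intro constant_acrossI[where c = 1]) auto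
    then show ?thesis using in_E[of J y z] yz by blast
  qed
  show ?thesis
    unfolding perp_eigen_def u_def[symmetric]
  proof (intro ballI impI)
    fix w assume w: "w \<in> V" "w \<bullet> u = 0"
    have "w = (\<Sum>h\<in>{0..d}. (w \<bullet> B h) *\<^sub>R A h)" by (rule expand_A[OF w(1)])
    also have "\<dots> = (w \<bullet> B a) *\<^sub>R J + (\<Sum>h\<in>{0..d}. (w \<bullet> B h - w \<bullet> B a) *\<^sub>R A h)"
      unfolding J_def scaleR_sum_right by (simp add: scaleR_diff_left sum_subtractf)
    also have "\<dots> \<in> E"
    proof (rule subspace_add[OF subspace_E], rule subspace_scale[OF subspace_E J_in_E],
        rule subspace_sum[OF subspace_E])
      fix h assume h: "h \<in> {0..d}"
      show "(w \<bullet> B h - w \<bullet> B a) *\<^sub>R A h \<in> E"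
      proof (cases "h = a \<or> h = b")
        case True
        then have "w \<bullet> B h - w \<bullet> B a = 0" using w by (auto simp: u_def inner_diff_right)
        then show ?thesis using subspace_0[OF subspace_E] by (simp only: scaleR_zero_left)
      qed (use h A_in_E subspace_scale[OF subspace_E] in auto)
    qed
    finally show "\<exists>c. w ** u = c *\<^sub>R u" unfolding E_def by blast
  qed
qed

section \<open>The star around the merged core\<close>

text \<open>
  The analogue of \<open>B\<close> for the relation obtained by merging \<open>a\<close> and \<open>b\<close>.
\<close>

definition merged :: "nat \<Rightarrow> nat \<Rightarrow> real^'x^'x" where
  "merged a b = (A a + A b) /\<^sub>R (weight a + weight b)"

text \<open>
  After merging \<open>a\<close> and \<open>b\<close>, this is the difference that has to span a module for the merged
  relation and \<open>x\<close> to fuse.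
\<close>

definition spoke :: "nat \<Rightarrow> nat \<Rightarrow> nat \<Rightarrow> real^'x^'x" where
  "spoke a b x = merged a b - B x"

definition perp :: "nat \<Rightarrow> nat \<Rightarrow> (real^'x^'x) set" where
  "perp a b = {w\<in>V. w \<bullet> (B a - B b) = 0}"

lemma merged_eq:
  assumes "core_pair a b"
  shows "merged a b = B a - (weight b / (weight a + weight b)) *\<^sub>R (B a - B b)"
proof -
  have pos: "weight a > 0" "weight b > 0" using weight_pos core_pair_le[OF assms] by auto
  have "A a /\<^sub>R K = (weight a / K) *\<^sub>R B a" "A b /\<^sub>R K = (weight b / K) *\<^sub>R B b" for K
    using pos by (simp_all add: B_def divide_inverse)
  then have "merged a b = (weight a / (weight a + weight b)) *\<^sub>R B a
      + (weight b / (weight a + weight b)) *\<^sub>R B b"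
    by (simp only: merged_def scaleR_add_right)
  also have "weight a / (weight a + weight b) = 1 - weight b / (weight a + weight b)"
    using pos by (simp add: eq_diff_eq flip: add_divide_distrib)
  finally show ?thesis by (simp add: algebra_simps)
qed

lemma merged_inner_B:
  assumes "core_pair a b" "x \<le> d"
  shows "merged a b \<bullet> B x = (if x = a \<or> x = b then 1 / (weight a + weight b) else 0)"
  using core_pair_le[OF assms(1)] assms(2)
  by (auto simp: merged_def inner_add_left A_inner_B divide_inverse)

lemma merged_inner_merged:
  assumes "core_pair a b"
  shows "merged a b \<bullet> merged a b = 1 / (weight a + weight b)"
  by (subst (2) merged_eq[OF assms])
    (use core_pair_le[OF assms] in \<open>simp add: inner_diff_right merged_inner_B[OF assms]\<close>)

lemma merged_in: "core_pair a b \<Longrightarrow> merged a b \<in> V"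
  unfolding merged_def by (intro closed_intros A_in) (auto simp: core_pair_def)

lemma inner_merged: "core_pair a b \<Longrightarrow> w \<in> perp a b \<Longrightarrow> w \<bullet> merged a b = w \<bullet> B a"
  by (simp add: merged_eq inner_diff_right perp_def)

lemma algebra_perp:
  assumes "5 \<le> d" "core_pair a b"
  shows "symmetric_matrix_algebra (perp a b)"
proof -
  have "A 0 = mat 1" using scheme by (simp add: symmetric_scheme_def)
  moreover have "A 0 \<bullet> (B a - B b) = 0"
    using assms by (auto simp: inner_diff_right A_inner_B core_pair_def)
  ultimately show ?thesis
    unfolding perp_def
    by (intro perp_algebra perp_eigen_core assms closed_intros B_in) (use core_pair_le[OF assms(2)] in auto)
qed

context
  fixes a b
  assumes d5: "5 \<le> d" and core: "core_pair a b"
begin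

lemma spoke_in_perp:
  assumes "x \<in> {1..d} - {a, b}"
  shows "spoke a b x \<in> perp a b"
  using assms core_pair_le[OF core] merged_inner_B[OF core, of a] merged_inner_B[OF core, of b]
  by (auto simp: perp_def spoke_def inner_diff_left inner_diff_right B_inner_B
      intro!: closed_intros merged_in core B_in)

lemma spoke_inner_spoke:
  assumes "x \<in> {1..d} - {a, b}" "y \<in> {1..d} - {a, b}" "x \<noteq> y"
  shows "spoke a b x \<bullet> spoke a b y = 1 / (weight a + weight b)"
  using assms merged_inner_B[OF core, of y] merged_inner_B[OF core, of x]
  by (simp add: spoke_def inner_diff_left inner_diff_right merged_inner_merged[OF core] B_inner_B
      inner_commute[of "B x"])

text \<open>
  If \<open>w\<close> is orthogonal to \<open>u = B a - B b\<close> and to the spoke, then it is constant across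
  \<open>{a, b, x}\<close>, so it multiplies the spoke into the plane of that triple; it also keeps the
  product orthogonal to \<open>u\<close>. The part of the plane orthogonal to \<open>u\<close> is the line of the spoke.
\<close>

lemma perp_eigen_spoke:
  assumes x: "x \<in> {1..d} - {a, b}"
  shows "perp_eigen (perp a b) (spoke a b x)"
  unfolding perp_eigen_def
proof (intro ballI impI)
  fix w assume w: "w \<in> perp a b" "w \<bullet> spoke a b x = 0"
  note ab = core_pair_le[OF core]
  define K where "K = weight a + weight b"
  have pos: "weight a > 0" "weight b > 0" "K > 0" using weight_pos ab by (auto simp: K_def add_pos_pos)
  have fus: "fuses d A {a, b, x}" using core x unfolding core_pair_def by blast
  have w_in: "w \<in> V" and "w \<bullet> B a = w \<bullet> B b" using w by (auto simp: perp_def inner_diff_right)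
  moreover have "w \<bullet> B x = w \<bullet> B a"
    using w inner_merged[OF core w(1)] by (simp add: spoke_def inner_diff_right)
  ultimately have w_const: "w \<in> constant_across {a, b, x}"
    by (intro constant_acrossI[where c = "w \<bullet> B a"]) auto
  interpret perp: symmetric_matrix_algebra "perp a b" by (rule algebra_perp[OF d5 core])
  define X where "X = w ** spoke a b x"
  have "X \<in> perp a b" unfolding X_def by (intro perp.mult_in w spoke_in_perp x)
  then have X_in: "X \<in> V" and "X \<bullet> B a = X \<bullet> B b" by (auto simp: perp_def inner_diff_right)
  then have ab_eq: "X \<bullet> A a / weight a = X \<bullet> A b / weight b"
    by (simp add: B_def divide_inverse_commute)
  have X_eq: "X = w ** (B a - B x) - (weight b / K) *\<^sub>R (w ** (B a - B b))"
    by (simp add: X_def spoke_def merged_eq[OF core] K_def matrix_bilinear_simps algebra_simps)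
  have zero: "X \<bullet> A h = 0" if "h \<le> d" "h \<notin> {a, b, x}" for h
    using fuses_module[OF fus w_const, of a x h] fuses_module[OF fus w_const, of a b h] that
    by (simp add: X_eq inner_diff_left)
  have "X \<bullet> (\<Sum>h\<in>{a, b, x}. A h) = 0"
    using fuses_module_sum[OF fus w_const, of a x] fuses_module_sum[OF fus w_const, of a b]
    by (simp add: X_eq inner_diff_left)
  then have sum: "X \<bullet> A a + X \<bullet> A b + X \<bullet> A x = 0" using x ab by (simp add: inner_add_right)
  have spoke_A: "spoke a b x \<bullet> A h = (if h = a then weight a / K else if h = b then weight b / K
      else if h = x then - 1 else 0)" if "h \<le> d" for h
    using x ab that by (auto simp: spoke_def merged_def K_def inner_diff_left inner_add_left B_inner_A
        A_inner_A_distinct weight_def divide_inverse)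
  have "X = - (X \<bullet> A x) *\<^sub>R spoke a b x"
  proof (rule eq_if_inner_A_eq[OF X_in])
    show "- (X \<bullet> A x) *\<^sub>R spoke a b x \<in> V"
      using spoke_in_perp[OF x] by (intro closed_intros) (simp add: perp_def)
    fix h assume h: "h \<le> d"
    have "X \<bullet> A a = (X \<bullet> A a + X \<bullet> A b) * weight a / K"
      "X \<bullet> A b = (X \<bullet> A a + X \<bullet> A b) * weight b / K"
      using ab_eq pos by (auto simp: field_simps K_def)
    moreover have "X \<bullet> A a + X \<bullet> A b = - (X \<bullet> A x)" using sum by simp
    ultimately have "X \<bullet> A a = - (X \<bullet> A x) * weight a / K" "X \<bullet> A b = - (X \<bullet> A x) * weight b / K"
      by simp_all
    then show "X \<bullet> A h = (- (X \<bullet> A x) *\<^sub>R spoke a b x) \<bullet> A h"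
      using zero[OF h] spoke_A[OF h] x ab by auto
  qed
  then show "\<exists>c. w ** spoke a b x = c *\<^sub>R spoke a b x" unfolding X_def by blast
qed

lemma spoke_inner_A:
  assumes "x \<in> {1..d} - {a, b}" "h \<in> {1..d} - {a, b}"
  shows "spoke a b x \<bullet> A h = - of_bool (x = h)"
  using assms core_pair_le[OF core]
  by (auto simp: spoke_def merged_def inner_diff_left inner_add_left B_inner_A A_inner_A_distinct)

lemma spokes_independent:
  assumes xyz: "x \<in> {1..d} - {a, b}" "y \<in> {1..d} - {a, b}" "z \<in> {1..d} - {a, b}"
    "x \<noteq> y" "y \<noteq> z" "x \<noteq> z"
    and 0: "p *\<^sub>R spoke a b x + q *\<^sub>R spoke a b y + r *\<^sub>R spoke a b z = 0"
  shows "p = 0 \<and> q = 0 \<and> r = 0"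
proof -
  have "(p *\<^sub>R spoke a b x + q *\<^sub>R spoke a b y + r *\<^sub>R spoke a b z) \<bullet> A h = 0" for h
    by (simp only: 0 inner_zero_left)
  from this[of x] this[of y] this[of z] show ?thesis
    using xyz(4-6) spoke_inner_A[OF xyz(1)] spoke_inner_A[OF xyz(2)] spoke_inner_A[OF xyz(3)] xyz(1-3)
    by (simp add: inner_add_left)
qed

lemma
  assumes xyz: "x \<in> {1..d} - {a, b}" "y \<in> {1..d} - {a, b}" "z \<in> {1..d} - {a, b}"
    "x \<noteq> y" "y \<noteq> z" "x \<noteq> z"
  shows spoke_product: "spoke a b x ** spoke a b y = spoke a b x ** spoke a b z"
    and perp_eigen_spoke_diff: "perp_eigen (perp a b) (B y - B x)"
proof -
  interpret perp: symmetric_matrix_algebra "perp a b" by (rule algebra_perp[OF d5 core])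
  have "weight a + weight b > 0" using weight_pos core_pair_le[OF core] by (auto intro: add_pos_pos)
  then have nz: "1 / (weight a + weight b) \<noteq> 0" by simp
  note star = spoke_in_perp[OF xyz(1)] spoke_in_perp[OF xyz(2)] spoke_in_perp[OF xyz(3)]
    perp_eigen_spoke[OF xyz(1)] perp_eigen_spoke[OF xyz(2)] perp_eigen_spoke[OF xyz(3)]
    spoke_inner_spoke[OF xyz(1,2,4)] spoke_inner_spoke[OF xyz(2,3,5)] spoke_inner_spoke[OF xyz(1,3,6)]
    nz spokes_independent[OF xyz]
  show "spoke a b x ** spoke a b y = spoke a b x ** spoke a b z"
    by (rule perp.star_product[OF star])
  have "perp_eigen (perp a b) (spoke a b x - spoke a b y)" by (rule perp.star_leaves[OF star])
  then show "perp_eigen (perp a b) (B y - B x)" by (simp add: spoke_def)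
qed

lemma core_diff:
  shows core_diff_in: "B a - B b \<in> V"
    and core_diff_inner_A: "(B a - B b) \<bullet> A a = 1"
    and core_diff_nonzero: "B a - B b \<noteq> 0"
proof -
  note ab = core_pair_le[OF core]
  show "B a - B b \<in> V" using ab by (intro closed_intros B_in) auto
  show "(B a - B b) \<bullet> A a = 1" using ab by (simp add: inner_diff_left B_inner_A)
  then show "B a - B b \<noteq> 0" by auto
qed

lemma perp_multiplies:
  assumes "w \<in> perp a b"
  obtains t where "w ** (B a - B b) = t *\<^sub>R (B a - B b)"
  using assms perp_eigenD[OF perp_eigen_core[OF d5 core]] unfolding perp_def by blast

lemma B_diff_in_perp:
  assumes "x \<in> {1..d} - {a, b}" "y \<in> {1..d} - {a, b}"
  shows "B x - B y \<in> perp a b"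
  using assms core_pair_le[OF core]
  by (auto simp: perp_def inner_diff_left inner_diff_right B_inner_B intro!: closed_intros B_in)

text \<open>
  The difference \<open>B x - B y\<close> of two spokes has the eigenvector property within the complement of
  \<open>u\<close>, using any third spoke \<open>z\<close>. The equality of products says that \<open>u\<close> annihilates it, so it
  remains an eigenvector when multiples of \<open>u\<close> are added.
\<close>

lemma perp_eigen_if_same_product:
  assumes xy: "x \<in> {1..d} - {a, b}" "y \<in> {1..d} - {a, b}" "x \<noteq> y"
    and same: "B x ** (B a - B b) = B y ** (B a - B b)"
  shows "perp_eigen V (B x - B y)"
  unfolding perp_eigen_def
proof (intro ballI impI)
  fix w assume w: "w \<in> V" "w \<bullet> (B x - B y) = 0"
  define u where "u = B a - B b"
  define m where "m = (w \<bullet> u) / (u \<bullet> u)"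
  have u: "u \<in> V" "u \<noteq> 0" using core_diff_in core_diff_nonzero by (simp_all add: u_def)
  have xy_perp: "B x - B y \<in> perp a b" by (rule B_diff_in_perp[OF xy(1,2)])
  have "(w - m *\<^sub>R u) \<bullet> u = 0" using u by (simp add: m_def inner_diff_left)
  moreover have "w - m *\<^sub>R u \<in> V" by (intro closed_intros w u)
  ultimately have "w - m *\<^sub>R u \<in> perp a b" by (simp add: perp_def u_def)
  moreover have "u \<bullet> (B x - B y) = 0" using xy_perp by (simp add: perp_def u_def inner_commute)
  then have "(w - m *\<^sub>R u) \<bullet> (B x - B y) = 0" using w by (simp add: inner_diff_left)
  moreover obtain z where z: "z \<in> {1..d}" "z \<notin> {a, b, x, y}"
    by (rule one_outside[of "{a, b, x, y}"]) (use d5 in \<open>auto simp: card_insert_if\<close>)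
  then have "z \<in> {1..d} - {a, b}" "x \<noteq> z" "y \<noteq> z" by blast+
  then have "perp_eigen (perp a b) (B x - B y)"
    using perp_eigen_spoke_diff xy by metis
  ultimately obtain c where c: "(w - m *\<^sub>R u) ** (B x - B y) = c *\<^sub>R (B x - B y)"
    by (meson perp_eigenD)
  have "u ** (B x - B y) = (B x - B y) ** u"
    using xy_perp u by (intro mult_commute) (auto simp: perp_def)
  also have "\<dots> = 0" using same by (simp add: u_def matrix_mult.diff_left)
  finally have "w ** (B x - B y) = c *\<^sub>R (B x - B y)"
    using c by (simp only: matrix_mult.diff_left matrix_mult.scaleR_left) simp
  then show "\<exists>c. w ** (B x - B y) = c *\<^sub>R (B x - B y)" ..
qed

end

section \<open>Two cores\<close>

text \<open>
  The matrix \<open>u = B a - B b\<close> has coefficient \<open>0\<close> at \<open>c\<close>, \<open>e\<close> and \<open>z\<close>, so it is constant across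
  \<open>{c, e, z}\<close> and multiplies \<open>B x - B c\<close> into a space supported on \<open>{c, e, z}\<close>. The product is also
  a multiple of \<open>u\<close>, which is supported on \<open>{a, b}\<close>, hence it is \<open>0\<close>.
\<close>

lemma same_product_disjoint:
  assumes d5: "5 \<le> d" and core: "core_pair a b" "core_pair c e"
    and disj: "{a, b} \<inter> {c, e} = {}" and x: "x \<in> {1..d} - {a, b}"
  shows "B x ** (B a - B b) = B c ** (B a - B b)"
proof -
  have ce: "c \<in> {1..d} - {a, b}" "e \<in> {1..d} - {a, b}"
    using core(2) disj by (auto simp: core_pair_def)
  note ab = core_pair_le[OF core(1)]
  obtain z where z: "z \<in> {1..d} - {a, b} - {c, e}" "x \<in> {c, e, z}"
  proof (cases "x \<in> {c, e}")
    case True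
    obtain z where "z \<in> {1..d}" "z \<notin> {a, b, c, e}"
      by (rule one_outside[of "{a, b, c, e}"]) (use d5 in \<open>auto simp: card_insert_if\<close>)
    then have "z \<in> {1..d} - {a, b} - {c, e}" by blast
    then show ?thesis using True that by blast
  next
    case False
    then have "x \<in> {1..d} - {a, b} - {c, e}" using x by blast
    then show ?thesis using that[of x] by blast
  qed
  have fus: "fuses d A {c, e, z}" using core(2) z unfolding core_pair_def by blast
  have "B a - B b \<in> constant_across {c, e, z}"
  proof (rule constant_acrossI[OF core_diff_in[OF d5 core(1)]])
    fix i assume "i \<in> {c, e, z}"
    then have "i \<in> {1..d} - {a, b}" using ce z(1) by blast
    then show "(B a - B b) \<bullet> B i = 0" using ab by (auto simp: inner_diff_left B_inner_B)
  qed
  moreover have "a \<notin> {c, e, z}" using ce z(1) by blast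
  ultimately have zero: "((B a - B b) ** (B x - B c)) \<bullet> A a = 0"
    using fuses_module[OF fus _ z(2), of _ c a] ab by blast
  obtain t where t: "(B x - B c) ** (B a - B b) = t *\<^sub>R (B a - B b)"
    using perp_multiplies[OF d5 core(1) B_diff_in_perp[OF d5 core(1) x ce(1)]] .
  have "(B a - B b) ** (B x - B c) = (B x - B c) ** (B a - B b)"
    using ab ce x by (intro mult_commute closed_intros B_in) auto
  then have "t = 0" using zero core_diff_inner_A[OF d5 core(1)] by (simp add: t)
  then show ?thesis using t by (simp add: matrix_mult.diff_left)
qed

text \<open>
  Let \<open>t x\<close> be the eigenvalue of \<open>spoke a b x\<close> on \<open>u\<close>. The product rule of the star around the
  merged core gives \<open>t x * t y = t x * t z\<close>, so all \<open>t\<close> agree once \<open>t y \<noteq> 0\<close> for all \<open>y\<close> outside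
  \<open>{a, b, c}\<close>. Suppose that \<open>t y = 0\<close>. The star of the other core \<open>{a, c}\<close> has
  \<open>spoke a c y ** (spoke a c x - spoke a c b) = 0\<close>. The spokes of the two stars differ by a
  combination of \<open>u\<close> and \<open>u' = B a - B c\<close>, and \<open>u'\<close> acts on \<open>u\<close> as \<open>\<beta> u + t c\<close>, so
  multiplication of this equation by \<open>u\<close> leaves a polynomial equation in \<open>u\<close> alone. Its linear term
  vanishes by \<open>t x * t c = t x * t y = 0\<close>, and its cubic coefficient is a product of the nonzero
  numbers \<open>1 - \<beta>\<close>, \<open>\<beta>\<close> and \<open>1 - \<gamma>\<close>. This is the equation excluded by \<open>eq_zero_if_cubic\<close>.
\<close>

lemma same_product_overlap:
  assumes d5: "5 \<le> d" and core: "core_pair a b" "core_pair a c" "b \<noteq> c"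
    and x: "x \<in> {1..d} - {a, b}"
  shows "B x ** (B a - B b) = B c ** (B a - B b)"
proof -
  define u where "u = B a - B b"
  define u' where "u' = B a - B c"
  define \<beta> where "\<beta> = weight b / (weight a + weight b)"
  define \<gamma> where "\<gamma> = weight c / (weight a + weight c)"
  have c_in: "c \<in> {1..d} - {a, b}" and b_in: "b \<in> {1..d} - {a, c}"
    using core by (auto simp: core_pair_def)
  have le: "a \<le> d" "b \<le> d" "c \<le> d" using core core_pair_le by auto
  then have "0 < weight a" "0 < weight b" "0 < weight c" using weight_pos by auto
  then have pos: "0 < \<beta>" "\<beta> < 1" "0 < \<gamma>" "\<gamma> < 1" by (simp_all add: \<beta>_def \<gamma>_def add_pos_pos)
  have u_in: "u \<in> V" "u' \<in> V" and u_nz: "u \<noteq> 0"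
    using core_diff_in[OF d5 core(1)] core_diff_in[OF d5 core(2)] core_diff_nonzero[OF d5 core(1)]
    by (simp_all add: u_def u'_def)
  have ab_spoke: "spoke a b x = B a - \<beta> *\<^sub>R u - B x" for x
    by (simp add: spoke_def merged_eq[OF core(1)] \<beta>_def u_def)
  have ac_spoke: "spoke a c x = spoke a b x + \<beta> *\<^sub>R u - \<gamma> *\<^sub>R u'" for x
    by (simp add: ab_spoke) (simp add: spoke_def merged_eq[OF core(2)] \<gamma>_def u'_def)
  have "\<forall>x\<in>{1..d} - {a, b}. \<exists>t. spoke a b x ** u = t *\<^sub>R u"
    unfolding u_def using perp_multiplies[OF d5 core(1) spoke_in_perp[OF d5 core(1)]] by blast
  then obtain t where t: "\<And>x. x \<in> {1..d} - {a, b} \<Longrightarrow> spoke a b x ** u = t x *\<^sub>R u" by metis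
  have t_product: "t x * t y = t x * t z"
    if x: "x \<in> {1..d} - {a, b}"
      and yz: "y \<in> {1..d} - {a, b}" "z \<in> {1..d} - {a, b}" "x \<noteq> y" "y \<noteq> z" "x \<noteq> z" for x y z
  proof -
    have prod: "(spoke a b x ** spoke a b w) ** u = (t x * t w) *\<^sub>R u" if "w \<in> {1..d} - {a, b}" for w
    proof -
      have "(spoke a b x ** spoke a b w) ** u = spoke a b x ** (t w *\<^sub>R u)"
        by (simp only: matrix_mul_assoc[symmetric] t[OF that])
      then show ?thesis by (simp only: matrix_mult.scaleR_right t[OF x] scaleR_scaleR mult.commute)
    qed
    have "(t x * t y) *\<^sub>R u = (t x * t z) *\<^sub>R u"
      unfolding prod[OF yz(1), symmetric] prod[OF yz(2), symmetric]
      using spoke_product[OF d5 core(1) x yz] by simp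
    then show ?thesis using u_nz by simp
  qed
  have spoke_in: "spoke a b x \<in> V" "spoke a c x \<in> V" if "x \<in> {1..d}" for x
    using that core unfolding spoke_def by (auto intro!: closed_intros merged_in B_in)
  have t_nonzero: "t y \<noteq> 0" if y: "y \<in> {1..d} - {a, b, c}" for y
  proof
    assume ty: "t y = 0"
    obtain x where x': "x \<in> {1..d}" "x \<notin> {a, b, c, y}"
      by (rule one_outside[of "{a, b, c, y}"]) (use d5 in \<open>auto simp: card_insert_if\<close>)
    then have x: "x \<in> {1..d} - {a, b}" "x \<in> {1..d} - {a, c}" "x \<noteq> y" "x \<noteq> c" "x \<noteq> b" by blast+
    have y': "y \<in> {1..d} - {a, b}" "y \<in> {1..d} - {a, c}" "y \<noteq> b" "y \<noteq> c" using y by blast+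
    have "t x * t c = t x * t y" by (rule t_product[OF x(1) c_in y'(1)]) (use x y' in blast)+
    then have txtc: "t x * t c = 0" using ty by simp
    have "u' = spoke a b c + \<beta> *\<^sub>R u" by (simp add: ab_spoke u'_def)
    then have u'u: "u' ** u = t c *\<^sub>R u + \<beta> *\<^sub>R (u ** u)"
      using t[OF c_in] by (simp add: matrix_bilinear_simps)
    define k where "k = \<beta> * (1 - \<gamma>)"
    define l where "l = \<gamma> * t c"
    define P where "P = spoke a c y"
    have P_in: "P \<in> V" using spoke_in y by (simp add: P_def)
    have Pu: "P ** u = k *\<^sub>R (u ** u) - l *\<^sub>R u"
      using t[OF y'(1)] ty
      by (simp add: P_def ac_spoke matrix_bilinear_simps u'u k_def l_def algebra_simps)
    have Puu: "P ** (u ** u) = k *\<^sub>R (u ** (u ** u)) - l *\<^sub>R (u ** u)"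
      by (simp only: mult_left_commute[OF P_in u_in(1)] Pu matrix_bilinear_simps)
    have "spoke a c x - spoke a c b = spoke a b x - (1 - \<beta>) *\<^sub>R u"
      by (simp add: ac_spoke ab_spoke[of b] u_def algebra_simps)
    then have diff: "(spoke a c x - spoke a c b) ** u = t x *\<^sub>R u - (1 - \<beta>) *\<^sub>R (u ** u)"
      using t[OF x(1)] by (simp add: matrix_bilinear_simps)
    have "P ** spoke a c x = P ** spoke a c b"
      unfolding P_def by (rule spoke_product[OF d5 core(2) y'(2) x(2) b_in]) (use x y' in blast)+
    then have "P ** (spoke a c x - spoke a c b) = 0" by (simp only: matrix_mult.diff_right) simp
    then have "P ** ((spoke a c x - spoke a c b) ** u) = 0"
      by (simp only: matrix_mul_assoc matrix_mult.zero_left)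
    then have "t x *\<^sub>R (k *\<^sub>R (u ** u) - l *\<^sub>R u)
        - (1 - \<beta>) *\<^sub>R (k *\<^sub>R (u ** (u ** u)) - l *\<^sub>R (u ** u)) = 0"
      unfolding diff by (simp only: matrix_bilinear_simps Pu Puu)
    moreover have "t x * l = 0" using txtc by (auto simp: l_def)
    ultimately have cube: "((1 - \<beta>) * k) *\<^sub>R (u ** (u ** u)) = (t x * k + (1 - \<beta>) * l) *\<^sub>R (u ** u)"
      by (simp add: scaleR_diff_right scaleR_add_left algebra_simps)
    have nz: "(1 - \<beta>) * k \<noteq> 0" using pos by (simp add: k_def)
    have "u ** (u ** u) = inverse ((1 - \<beta>) * k) *\<^sub>R (((1 - \<beta>) * k) *\<^sub>R (u ** (u ** u)))"
      by (simp only: scaleR_scaleR left_inverse[OF nz] scaleR_one)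
    also have "\<dots> = (inverse ((1 - \<beta>) * k) * (t x * k + (1 - \<beta>) * l)) *\<^sub>R (u ** u)"
      by (simp only: cube scaleR_scaleR)
    finally have "u ** (u ** u) = (inverse ((1 - \<beta>) * k) * (t x * k + (1 - \<beta>) * l)) *\<^sub>R (u ** u)" .
    moreover have "mat 1 \<bullet> u = 0"
    proof -
      have "A 0 = mat 1" using scheme by (simp add: symmetric_scheme_def)
      moreover have "A 0 \<bullet> u = 0"
        using core(1) by (auto simp: u_def inner_diff_right A_inner_B core_pair_def)
      ultimately show ?thesis by simp
    qed
    ultimately show False using eq_zero_if_cubic u_in u_nz by blast
  qed
  have "t x = t c"
  proof (cases "x = c")
    case False
    obtain y where y: "y \<in> {1..d}" "y \<notin> {a, b, c, x}"
      by (rule one_outside[of "{a, b, c, x}"]) (use d5 in \<open>auto simp: card_insert_if\<close>)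
    then have "y \<in> {1..d} - {a, b}" "y \<noteq> x" "y \<noteq> c" by auto
    then have "t y * t x = t y * t c" using t_product x c_in False by metis
    moreover have "t y \<noteq> 0" using t_nonzero y by simp
    ultimately show ?thesis by simp
  qed simp
  then have "spoke a b x ** u = spoke a b c ** u" using t x c_in by simp
  then show ?thesis by (simp add: spoke_def matrix_mult.diff_left flip: u_def)
qed

lemma star_pair:
  assumes "c \<in> {1..d}" "x \<in> {1..d}" "y \<in> {1..d}" "z \<in> {1..d}"
    and dist: "distinct [c, x, y, z]"
    and "perp_eigen V (B c - B x)" "perp_eigen V (B c - B y)" "perp_eigen V (B c - B z)"
  shows "perp_eigen V (B x - B y)"
proof -
  have inner: "(B c - B i) \<bullet> (B c - B j) = 1 / weight c" if "i \<in> {1..d} - {c}" "j \<in> {1..d} - {c}" "i \<noteq> j" for i j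
    using that assms(1) by (auto simp: inner_diff_left inner_diff_right B_inner_B)
  have indep: "p = 0 \<and> q = 0 \<and> r = 0"
    if 0: "p *\<^sub>R (B c - B x) + q *\<^sub>R (B c - B y) + r *\<^sub>R (B c - B z) = 0" for p q r
  proof -
    have "(p *\<^sub>R (B c - B x) + q *\<^sub>R (B c - B y) + r *\<^sub>R (B c - B z)) \<bullet> A h = 0" for h
      by (simp only: 0 inner_zero_left)
    from this[of x] this[of y] this[of z] show ?thesis
      using assms(1-4) dist by (simp add: inner_add_left inner_diff_left B_inner_A)
  qed
  have "perp_eigen V ((B c - B x) - (B c - B y))"
  proof (rule star_leaves)
    show "B c - B x \<in> V" "B c - B y \<in> V" "B c - B z \<in> V"
      using assms(1-4) by (auto intro!: closed_intros B_in)
    show "(B c - B x) \<bullet> (B c - B y) = 1 / weight c" "(B c - B y) \<bullet> (B c - B z) = 1 / weight c"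
      "(B c - B x) \<bullet> (B c - B z) = 1 / weight c"
      using assms(1-4) dist by (auto intro!: inner)
    show "1 / weight c \<noteq> 0" using weight_nonzero[of c] assms(1) by simp
  qed (fact assms indep)+
  then have "perp_eigen V (B y - B x)" by simp
  then show ?thesis by (simp only: perp_eigen_minus_commute[of V "B x"])
qed

text \<open>Every pair of indices other than \<open>x\<close> belongs to three leaves of the star around \<open>x\<close>.\<close>

lemma amorphic_if_dominating:
  assumes "4 \<le> d" "x \<in> {1..d}"
    and dom: "\<And>y. y \<in> {1..d} \<Longrightarrow> y \<noteq> x \<Longrightarrow> perp_eigen V (B x - B y)"
  shows "amorphic d A"
proof (rule amorphic_if_all_pairs)
  fix i j assume ij: "i \<in> {1..d}" "j \<in> {1..d}" "i \<noteq> j"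
  obtain z where z: "z \<in> {1..d}" "z \<notin> {x, i, j}"
    by (rule one_outside[of "{x, i, j}"]) (use assms(1) in \<open>auto simp: card_insert_if\<close>)
  consider "i = x" | "j = x" | "i \<noteq> x" "j \<noteq> x" by blast
  then show "perp_eigen V (B i - B j)"
  proof cases
    case 1
    then show ?thesis using dom[OF ij(2)] ij(3) by simp
  next
    case 2
    then have "perp_eigen V (B x - B i)" using dom[OF ij(1)] ij(3) by simp
    then show ?thesis using 2 by (simp only: perp_eigen_minus_commute[of V "B i"])
  next
    case 3
    show ?thesis
      by (rule star_pair[OF assms(2) ij(1,2) z(1) _ dom[OF ij(1)] dom[OF ij(2)] dom[OF z(1)]])
        (use 3 ij z in auto)
  qed
qed

lemma amorphic_if_disjoint_cores:
  assumes d5: "5 \<le> d" and core: "core_pair a b" "core_pair c e"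
    and disj: "{a, b} \<inter> {c, e} = {}"
  shows "amorphic d A"
proof -
  have ab: "perp_eigen V (B x - B y)" if "x \<in> {1..d} - {a, b}" "y \<in> {1..d} - {a, b}" "x \<noteq> y" for x y
    using perp_eigen_if_same_product[OF d5 core(1) that] same_product_disjoint[OF d5 core disj] that by simp
  have disj': "{c, e} \<inter> {a, b} = {}" using disj by blast
  have ce: "perp_eigen V (B x - B y)" if "x \<in> {1..d} - {c, e}" "y \<in> {1..d} - {c, e}" "x \<noteq> y" for x y
    using perp_eigen_if_same_product[OF d5 core(2) that] same_product_disjoint[OF d5 core(2,1) disj'] that by simp
  obtain x where x: "x \<in> {1..d}" "x \<notin> {a, b, c, e}"
    by (rule one_outside[of "{a, b, c, e}"]) (use d5 in \<open>auto simp: card_insert_if\<close>)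
  show ?thesis
  proof (rule amorphic_if_dominating)
    show "4 \<le> d" "x \<in> {1..d}" using d5 x by auto
    show "perp_eigen V (B x - B y)" if "y \<in> {1..d}" "y \<noteq> x" for y
    proof (cases "y \<in> {a, b}")
      case True
      then have "x \<in> {1..d} - {c, e}" "y \<in> {1..d} - {c, e}" using x that(1) disj by blast+
      then show ?thesis using ce that(2) by metis
    next
      case False
      then have "x \<in> {1..d} - {a, b}" "y \<in> {1..d} - {a, b}" using x that(1) by blast+
      then show ?thesis using ab that(2) by metis
    qed
  qed
qed

lemma amorphic_if_overlapping_cores:
  assumes d5: "5 \<le> d" and core: "core_pair a b" "core_pair a c" "b \<noteq> c"
  shows "amorphic d A"
proof -
  have ab: "perp_eigen V (B x - B y)" if "x \<in> {1..d} - {a, b}" "y \<in> {1..d} - {a, b}" "x \<noteq> y" for x y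
    using perp_eigen_if_same_product[OF d5 core(1) that] same_product_overlap[OF d5 core] that by simp
  have ac: "perp_eigen V (B x - B y)" if "x \<in> {1..d} - {a, c}" "y \<in> {1..d} - {a, c}" "x \<noteq> y" for x y
    using perp_eigen_if_same_product[OF d5 core(2) that]
      same_product_overlap[OF d5 core(2,1) core(3)[symmetric]] that by simp
  have in_d: "a \<in> {1..d}" "b \<in> {1..d}" "c \<in> {1..d}" "a \<noteq> b" "a \<noteq> c"
    using core by (auto simp: core_pair_def)
  obtain x z where x: "x \<in> {1..d}" "x \<notin> {a, b, c}" and z: "z \<in> {1..d}" "z \<notin> {a, b, c}" and "x \<noteq> z"
    by (rule two_outside[of "{a, b, c}"]) (use d5 in \<open>auto simp: card_insert_if\<close>)
  \<comment> \<open>The pairs \<open>{a, x}\<close> meet both cores; the star around \<open>c\<close> with leaves \<open>x\<close>, \<open>a\<close>, \<open>z\<close> supplies them.\<close>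
  have "perp_eigen V (B c - B a)"
    using perp_eigen_core[OF d5 core(2)] perp_eigen_minus_commute by blast
  moreover have "perp_eigen V (B c - B x)" "perp_eigen V (B c - B z)"
    by (rule ab; use in_d x z core(3) in blast)+
  moreover have "distinct [c, x, a, z]" using in_d(5) x z \<open>x \<noteq> z\<close> by (simp; blast)
  ultimately have "perp_eigen V (B x - B a)" using star_pair in_d x z by metis
  then have "perp_eigen V (B x - B y)" if "y \<in> {1..d}" "y \<noteq> x" for y
    using that x in_d core(3) ab[of x y] ac[of x y] by blast
  then show ?thesis using amorphic_if_dominating[of x] x d5 by simp
qed

section \<open>Sunflowers of fusing triples\<close>

lemma inj_on_A: "inj_on A {0..d}"
proof (rule inj_onI, rule ccontr)
  fix i j assume "i \<in> {0..d}" "j \<in> {0..d}" "A i = A j" "i \<noteq> j"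
  then show False using A_inner_A_distinct[of i j] A_inner_pos[of i] by simp
qed

text \<open>
  Every vertex \<open>A x\<close> outside the core lies on an edge, and an edge consists of the two vertices of
  the core and one more. Distinctness of the matrices recovers the triple of indices.
\<close>

lemma sunflower_core:
  assumes S: "three_sunflower S" "hverts S = A ` {1..d}" "subhypergraph S (fusing_hypergraph d A)"
  obtains a b where "core_pair a b" "core S = {A a, A b}"
proof -
  have uniform: "\<And>E. E \<in> hedges S \<Longrightarrow> E \<subseteq> A ` {1..d} \<and> card E = 3"
    and nonempty: "hedges S \<noteq> {}" and cover: "\<Union>(hedges S) = A ` {1..d}" and "card (core S) = 2"
    using S by (auto simp: three_sunflower_def three_uniform_def)
  have core_sub: "core S \<subseteq> E" if "E \<in> hedges S" for E using that by (auto simp: core_def)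
  then have sub: "core S \<subseteq> A ` {1..d}" using nonempty uniform by blast
  obtain p q where pq: "core S = {p, q}" "p \<noteq> q" using \<open>card (core S) = 2\<close> by (auto simp: card_2_iff)
  have "p \<in> A ` {1..d}" "q \<in> A ` {1..d}" using sub unfolding pq(1) by simp_all
  then obtain a b where "a \<in> {1..d}" "p = A a" "b \<in> {1..d}" "q = A b" by (elim imageE)
  then have ab: "a \<in> {1..d}" "b \<in> {1..d}" "core S = {A a, A b}" "A a \<noteq> A b" using pq by simp_all
  have "fuses d A {a, b, x}" if x: "x \<in> {1..d} - {a, b}" for x
  proof -
    obtain E where E: "E \<in> hedges S" "A x \<in> E" using cover x by blast
    then obtain J where J: "E = A ` J" "J \<subseteq> {1..d}" "fuses d A J" "card J = 3"
      using S(3) unfolding subhypergraph_def fusing_hypergraph_def by auto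
    have inj: "inj_on A {1..d}" by (rule inj_on_subset[OF inj_on_A]) auto
    have in_J: "h \<in> J" if "h \<in> {1..d}" "A h \<in> E" for h
      using inj_on_image_mem_iff[OF inj that(1) J(2)] that(2) J(1) by blast
    have "A a \<in> E" "A b \<in> E" using core_sub[OF E(1)] ab(3) by blast+
    then have "{a, b, x} \<subseteq> J" using in_J ab(1,2) E(2) x by blast
    moreover have "a \<noteq> b" using ab(4) by auto
    then have "card {a, b, x} = 3" using x by auto
    moreover have "finite J" using J(2) finite_subset by blast
    ultimately have "{a, b, x} = J" using J(4) by (metis card_subset_eq)
    then show ?thesis using J by simp
  qed
  moreover have "a \<noteq> b" using ab(4) by auto
  ultimately have "core_pair a b" using ab unfolding core_pair_def by blast
  then show ?thesis using that ab by blast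
qed

end

theorem theorem1p3:
  fixes d :: nat
    and A :: "nat \<Rightarrow> real^'x^'x"
    and S1 S2 :: "(real^'x^'x) hypergraph"
  assumes "d \<ge> 5"
    and "symmetric_scheme {0..d} 0 A"
    and "three_sunflower S1" and "hverts S1 = A ` {1..d}"
    and "three_sunflower S2" and "hverts S2 = A ` {1..d}"
    and "core S1 \<noteq> core S2"
    and "subhypergraph S1 (fusing_hypergraph d A)"
    and "subhypergraph S2 (fusing_hypergraph d A)"
  shows "amorphic d A"
proof -
  interpret scheme d A by unfold_locales (rule assms(2))
  obtain a b where ab: "core_pair a b" "core S1 = {A a, A b}"
    by (rule sunflower_core[OF assms(3,4,8)])
  obtain c e where ce: "core_pair c e" "core S2 = {A c, A e}"
    by (rule sunflower_core[OF assms(5,6,9)])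
  have neq: "{a, b} \<noteq> {c, e}" using ab(2) ce(2) assms(7) by auto
  note ba = ab(1)[unfolded core_pair_commute[of a b]] and ec = ce(1)[unfolded core_pair_commute[of c e]]
  consider "{a, b} \<inter> {c, e} = {}" | "a = c" "b \<noteq> e" | "a = e" "b \<noteq> c" | "b = c" "a \<noteq> e" | "b = e" "a \<noteq> c"
    using neq by auto
  then show ?thesis
  proof cases
    case 1
    then show ?thesis using amorphic_if_disjoint_cores[OF assms(1) ab(1) ce(1)] by blast
  qed (use amorphic_if_overlapping_cores[OF assms(1)] ab(1) ba ce(1) ec in blast)+
qed

end
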